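(* Let $p(x)$, $r(x)$ and $g(x)$ be functions that are continuous at zero. Let $y(x)$ be any solution of the second-order $q$-difference equation $$\frac{1}{q}D_{q^{-1}}D_q y(x)+p(x)D_{q^{-1}}y(x)+r(x)y(x)=g(x).$$ Let $h(x)$ be an arbitrary function and let $f(x)$ be a solution of the first-order $q$-difference equation $$\frac1q D_{q^{-1}}f(x)=p(x)f(x).$$ Then $$\int f(x)\Big(\frac1q D_{q^{-1}}D_qh(x)+p(x)D_{q^{-1}}h(x)+r(x)h(x)\Big)y(x)\,d_qx=f(x/q)\Big(y(x/q)\,D_{q^{-1}}h(x)-h(x/q)\,D_{q^{-1}}y(x)\Big)+\int f(x)h(x)g(x)\,d_qx.$$
   Context: Here $0<q<1$. All functions are complex-valued, defined on a set $A$ with $0\in A$ such that $x\in A$ implies $qx\in A$ and $x/q\in A$. The $q$-derivative is $D_qf(x)=\frac{f(x)-f(qx)}{(1-q)x}$ for $x\ne0$ (and $D_qf(0)=f'(0)$ if this exists); $D_{q^{-1}}$ is the same operator with $q$ replaced by $q^{-1}$, i.e. $D_{q^{-1}}f(x)=\frac{f(x)-f(x/q)}{(1-q^{-1})x}$ for $x\neq0$. An indefinite $q$-integral $\int F(x)\,d_qx$ denotes a $q$-antiderivative of $F$. An identity $\int F\,d_qx=G(x)+\int E\,d_qx$ means $F(x)=D_qG(x)+E(x)$ for all nonzero $x$ in the domain. The $q$-difference equations are likewise understood at nonzero $x$. *)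

theory Defs
  imports "HOL-Analysis.Analysis"
begin

text \<open>
  Functions on a domain \<open>A\<close> are total functions of which only the values on \<open>A\<close> matter.
  The domain is a set of complex numbers; a real domain is the special case of a subset of
  \<open>\<real>\<close>. Continuity and differentiability at zero are relative to \<open>A\<close>.
\<close>

definition q_domain :: "real \<Rightarrow> complex set \<Rightarrow> bool" where
  "q_domain q A \<longleftrightarrow>
     0 \<in> A \<and> (\<forall>x\<in>A. complex_of_real q * x \<in> A \<and> x / complex_of_real q \<in> A)"

text \<open>
  The parameter \<open>q\<close> is an arbitrary real number, so that the operator for the base \<open>1/q\<close> is
  \<open>qderiv A (1/q)\<close>. The value at zero is unspecified if the derivative does not exist.
\<close>

definition qderiv :: "complex set \<Rightarrow> real \<Rightarrow> (complex \<Rightarrow> complex) \<Rightarrow> complex \<Rightarrow> complex" where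
  "qderiv A q f x =
     (if x = 0 then (THE d. (f has_field_derivative d) (at 0 within A))
      else (f x - f (complex_of_real q * x)) / ((1 - complex_of_real q) * x))"

text \<open>
  \<open>qint_identity A q F G E\<close> is the identity \<open>\<integral> F d\<^sub>qx = G + \<integral> E d\<^sub>qx\<close> between indefinite
  \<open>q\<close>-integrals, which are determined only up to functions with vanishing \<open>q\<close>-derivative:
  it asserts that both sides have the same \<open>q\<close>-derivative.
\<close>

definition qint_identity ::
  "complex set \<Rightarrow> real \<Rightarrow> (complex \<Rightarrow> complex) \<Rightarrow> (complex \<Rightarrow> complex) \<Rightarrow> (complex \<Rightarrow> complex) \<Rightarrow> bool"
  where
  "qint_identity A q F G E \<longleftrightarrow> (\<forall>x\<in>A - {0}. F x = qderiv A q G x + E x)"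

end

theory Submission
  imports Defs
begin

text \<open>
  The result is a \<open>q\<close>-analogue of the Lagrange identity for a second-order operator in
  self-adjoint form. Let \<open>W = y \<cdot> D\<^sub>q h - h \<cdot> D\<^sub>q y\<close> be the \<open>q\<close>-Wronskian. Since
  \<open>D\<^bsub>1/q\<^esub> u (x) = D\<^sub>q u (x/q)\<close> (lemma \<open>qderiv_inverse_base\<close>), the integrated term is
  \<open>G(x) = (f \<cdot> W)(x/q)\<close>, so that \<open>D\<^sub>q G = (1/q) D\<^bsub>1/q\<^esub> (f \<cdot> W)\<close> (lemma
  \<open>qderiv_shift\<close>). The Leibniz rule and the equation for the integrating factor \<open>f\<close> give
  \<open>D\<^sub>q G (x) = f(x) (p(x) W(x/q) + (1/q) D\<^bsub>1/q\<^esub> W (x))\<close>.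

  Two cancellations finish the proof. In \<open>D\<^bsub>1/q\<^esub> W\<close> the products of first derivatives
  cancel, which leaves only \<open>y \<cdot> D\<^bsub>1/q\<^esub> D\<^sub>q h - h \<cdot> D\<^bsub>1/q\<^esub> D\<^sub>q y\<close> (lemma
  \<open>qderiv_q_wronskian\<close>). In \<open>W(x/q)\<close> the undifferentiated values \<open>y(x/q)\<close> and
  \<open>h(x/q)\<close> may be replaced by \<open>y(x)\<close> and \<open>h(x)\<close>, because a difference quotient
  determines the difference (lemma \<open>q_wronskian_shift\<close>). What results is
  \<open>f (y \<cdot> L h - h \<cdot> L y)\<close>, where \<open>L\<close> is the second-order operator, as the two terms
  with \<open>r\<close> cancel; now \<open>L y = g\<close>.
\<close>

text \<open>
  Both sides are the difference quotient over the pair of points \<open>x\<close>, \<open>x/q\<close>. This is what turns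
  the backward derivatives in the integrated term into shifted forward ones.
\<close>

lemma qderiv_inverse_base:
  assumes "q \<noteq> 0" "x \<noteq> 0"
  shows "qderiv A (1/q) u x = qderiv A q u (x / complex_of_real q)"
proof (cases "q = 1")
  case True
  then show ?thesis by simp
next
  case False
  then have "complex_of_real q \<noteq> 1" by simp
  with assms show ?thesis
    by (simp add: qderiv_def divide_simps) (simp add: algebra_simps)
qed

lemma qderiv_shift:
  assumes "q \<noteq> 0" "x \<noteq> 0"
  shows "qderiv A q (\<lambda>t. u (t / complex_of_real q)) x
           = 1 / complex_of_real q * qderiv A (1/q) u x"
  using assms by (simp add: qderiv_inverse_base) (simp add: qderiv_def)

lemma qderiv_mult:
  assumes "x \<noteq> 0"
  shows "qderiv A b (\<lambda>t. u t * v t) x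
           = qderiv A b u x * v (complex_of_real b * x) + u x * qderiv A b v x"
  using assms by (simp add: qderiv_def flip: add_divide_distrib) (simp add: algebra_simps)

lemma qderiv_diff:
  assumes "x \<noteq> 0"
  shows "qderiv A b (\<lambda>t. u t - v t) x = qderiv A b u x - qderiv A b v x"
  using assms by (simp add: qderiv_def flip: diff_divide_distrib)

text \<open>
  For rewriting under the operator with identities that, like \<open>qderiv_inverse_base\<close>, come from
  difference quotients and so are stated away from zero.
\<close>

lemma qderiv_cong_nonzero:
  assumes "\<And>t. t \<noteq> 0 \<Longrightarrow> u t = v t" "b \<noteq> 0" "x \<noteq> 0"
  shows "qderiv A b u x = qderiv A b v x"
  using assms by (simp add: qderiv_def)

definition q_wronskian ::
  "complex set \<Rightarrow> real \<Rightarrow> (complex \<Rightarrow> complex) \<Rightarrow> (complex \<Rightarrow> complex) \<Rightarrow> complex \<Rightarrow> complex"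
  where "q_wronskian A q y h x = y x * qderiv A q h x - h x * qderiv A q y x"

text \<open>
  In the Leibniz rule the second factors \<open>D\<^sub>q h\<close> and \<open>D\<^sub>q y\<close> are evaluated at \<open>x/q\<close>, where they
  equal the \<open>1/q\<close>-derivatives at \<open>x\<close>. Hence the two terms with first derivatives are both
  \<open>D\<^bsub>1/q\<^esub> y (x) \<cdot> D\<^bsub>1/q\<^esub> h (x)\<close> and cancel.
\<close>

lemma qderiv_q_wronskian:
  assumes "q \<noteq> 0" "x \<noteq> 0"
  shows "qderiv A (1/q) (q_wronskian A q y h) x
           = y x * qderiv A (1/q) (qderiv A q h) x - h x * qderiv A (1/q) (qderiv A q y) x"
proof -
  have "qderiv A (1/q) (q_wronskian A q y h) x
          = qderiv A (1/q) (\<lambda>t. y t * qderiv A q h t - h t * qderiv A q y t) x"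
    by (simp add: q_wronskian_def[abs_def])
  also have "\<dots> = (qderiv A (1/q) y x * qderiv A q h (x / complex_of_real q)
                     + y x * qderiv A (1/q) (qderiv A q h) x)
                - (qderiv A (1/q) h x * qderiv A q y (x / complex_of_real q)
                     + h x * qderiv A (1/q) (qderiv A q y) x)"
    using assms(2) by (simp add: qderiv_diff qderiv_mult)
  finally show ?thesis
    using assms by (simp flip: qderiv_inverse_base)
qed

text \<open>
  Replacing \<open>y(x/q)\<close> and \<open>h(x/q)\<close> by \<open>y(x)\<close> and \<open>h(x)\<close> changes the two terms of the Wronskian by
  the same multiple of \<open>D\<^bsub>1/q\<^esub> y (x) \<cdot> D\<^bsub>1/q\<^esub> h (x)\<close>.
\<close>

lemma q_wronskian_shift:
  assumes "q \<noteq> 0" "q \<noteq> 1" "x \<noteq> 0"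
  shows "q_wronskian A q y h (x / complex_of_real q) = q_wronskian A (1/q) y h x"
proof -
  let ?k = "(1 - complex_of_real (1/q)) * x"
  have "?k \<noteq> 0"
    using assms by (simp add: divide_simps)
  then have value_shift: "u (x / complex_of_real q) = u x - ?k * qderiv A (1/q) u x" for u
    using assms(3) by (simp add: qderiv_def)
  have "q_wronskian A q y h (x / complex_of_real q)
          = y (x / complex_of_real q) * qderiv A (1/q) h x
            - h (x / complex_of_real q) * qderiv A (1/q) y x"
    using assms by (simp add: q_wronskian_def qderiv_inverse_base)
  also have "\<dots> = q_wronskian A (1/q) y h x"
    unfolding value_shift[of y] value_shift[of h] q_wronskian_def by (simp add: algebra_simps)
  finally show ?thesis .
qed

theorem theorem4p1:
  fixes q :: real and A :: "complex set"
    and p r g y h f :: "complex \<Rightarrow> complex"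
  assumes "0 < q" and "q < 1"
    and "q_domain q A"
    and "continuous (at 0 within A) p"
    and "continuous (at 0 within A) r"
    and "continuous (at 0 within A) g"
    and "\<And>x. x \<in> A \<Longrightarrow> x \<noteq> 0 \<Longrightarrow>
           1 / complex_of_real q * qderiv A (1/q) (qderiv A q y) x
             + p x * qderiv A (1/q) y x + r x * y x = g x"
    and "\<And>x. x \<in> A \<Longrightarrow> x \<noteq> 0 \<Longrightarrow>
           1 / complex_of_real q * qderiv A (1/q) f x = p x * f x"
  shows "qint_identity A q
    (\<lambda>x. f x * (1 / complex_of_real q * qderiv A (1/q) (qderiv A q h) x
                  + p x * qderiv A (1/q) h x + r x * h x) * y x)
    (\<lambda>x. f (x / complex_of_real q) *
           (y (x / complex_of_real q) * qderiv A (1/q) h x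
              - h (x / complex_of_real q) * qderiv A (1/q) y x))
    (\<lambda>x. f x * h x * g x)"
proof -
  let ?c = "complex_of_real q"
  let ?W = "q_wronskian A q y h"
  let ?G = "\<lambda>x. f (x / ?c) * (y (x / ?c) * qderiv A (1/q) h x - h (x / ?c) * qderiv A (1/q) y x)"
  have q: "q \<noteq> 0" "q \<noteq> 1"
    using assms(1,2) by auto
  have "f x * (1 / ?c * qderiv A (1/q) (qderiv A q h) x + p x * qderiv A (1/q) h x + r x * h x) * y x
          = qderiv A q ?G x + f x * h x * g x" if x: "x \<in> A" "x \<noteq> 0" for x
  proof -
    have "qderiv A q ?G x = qderiv A q (\<lambda>t. f (t / ?c) * ?W (t / ?c)) x"
      using q x(2) by (intro qderiv_cong_nonzero) (simp_all add: q_wronskian_def qderiv_inverse_base)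
    also have "\<dots> = 1 / ?c * qderiv A (1/q) (\<lambda>t. f t * ?W t) x"
      using q(1) x(2) by (rule qderiv_shift[where u = "\<lambda>t. f t * ?W t"])
    also have "\<dots> = (1 / ?c * qderiv A (1/q) f x) * ?W (x / ?c)
                    + f x * (1 / ?c * qderiv A (1/q) ?W x)"
      using x(2) by (simp add: qderiv_mult ring_distribs)
    also have "\<dots> = p x * f x * q_wronskian A (1/q) y h x
                    + f x * (1 / ?c * (y x * qderiv A (1/q) (qderiv A q h) x
                                       - h x * qderiv A (1/q) (qderiv A q y) x))"
      using assms(8)[OF x] q x(2) by (simp add: q_wronskian_shift qderiv_q_wronskian)
    finally show ?thesis
      unfolding assms(7)[OF x, symmetric] q_wronskian_def by (simp add: algebra_simps)
  qed
  then show ?thesis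
    by (simp add: qint_identity_def)
qed

end
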